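(* Consider the multi-level, multi-user caching problem described in the context, with parameters $K\ge 1$, $L\ge 1$, $\{N_i,U_i\}_{i=1}^L$ satisfying the two regularity conditions, and cache memory $M\ge 0$. Let $R(M)$ be the rate achieved by the memory-sharing scheme defined in the context, and let $R^\ast(M)$ be the optimal rate. Then \[ R(M)\le 192\, R^\ast(M). \]
   Context: Multi-level, multi-user caching problem. A server holds $\sum_{i=1}^L N_i$ files, each of $F$ bits, partitioned into $L$ popularity levels, level $i$ consisting of $N_i$ files. There are $K$ caches, each able to store $MF$ bits. In a placement phase (before requests are known) arbitrary functions of the files are stored in the caches. Then, for each level $i$ and each cache, exactly $U_i$ users are connected to that cache and each of them requests an arbitrary file of level $i$ (a demand is any such assignment of requested files). The server then sends one broadcast message of $RF$ bits heard by all users, and each user must recover its requested file from the broadcast and the contents of the cache it is connected to. A pair $(R,M)$ is achievable if there is a placement-and-delivery strategy with caches of memory $M$ that, for every admissible demand, uses a broadcast of rate at most $R$ satisfying all requests (with vanishing error probability as $F\to\infty$). The optimal rate is $R^\ast(M)=\inf\{R:(R,M)\text{ achievable}\}$. Regularity conditions: (1) $N_i\ge KU_i$ for every $i$; (2) with $\beta=1/80$, for any two distinct levels $i,j$ with $U_i/N_i\ge U_j/N_j$, one has $\frac{U_i/N_i}{U_j/N_j}\ge 1/\beta^2$. Single-level rate: for $M\ge0$, $R^{\mathrm{SL}}(M,K,N,U)=U\cdot\min\{N/M,\,K\}\cdot(1-M/N)$ (with $N/0=\infty$). Memory-sharing scheme: level $i$ is given memory $\alpha_iM$ with $\alpha_i\in[0,1]$,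 $\sum_i\alpha_i=1$, and is served as a separate single-level system, giving total rate $R(M)=\sum_{i=1}^L R^{\mathrm{SL}}(\alpha_iM,K,N_i,U_i)$. The allocation is as follows. For a subset $A$ of levels put $S_A=\sum_{i\in A}\sqrt{N_iU_i}$, $T_A=\sum_{i\in A}N_i$, $V_A=\sum_{i\in A}N_i/K$. For $M<\sum_iN_i$, an $M$-feasible partition is a partition $(H,I,J)$ of $\{1,\dots,L\}$ with $I\neq\emptyset$ such that, writing $\tilde M=(M-T_J+V_I)/S_I$: $\tilde M<(1/K)\sqrt{N_h/U_h}$ for all $h\in H$; $(1/K)\sqrt{N_i/U_i}\le\tilde M\le(1+1/K)\sqrt{N_i/U_i}$ for all $i\in I$; $(1+1/K)\sqrt{N_j/U_j}<\tilde M$ for all $j\in J$ (such a partition exists). Given it, set $\alpha_hM=0$ for $h\in H$, $\alpha_iM=\sqrt{N_iU_i}\,\tilde M-N_i/K$ for $i\in I$, $\alpha_jM=N_j$ for $j\in J$. (If $M\ge\sum_iN_i$, every level stores all its files, $\alpha_iM=N_i$.) *)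

theory Defs
  imports Complex_Main
begin

text \<open>Levels are indexed by 0..<L, caches by 0..<K, users of level i at a cache by 0..<U i.
  File n of level i is indexed by the pair (i, n) with n < N i.\<close>

text \<open>A library realisation with files of F bits: every file is a bit string of length F;
  positions that are not files carry the empty string (extensionality).\<close>
definition databases :: "nat \<Rightarrow> (nat \<Rightarrow> nat) \<Rightarrow> nat \<Rightarrow> (nat \<times> nat \<Rightarrow> bool list) set" where
  "databases L N F = {db. (\<forall>i n. i < L \<and> n < N i \<longrightarrow> length (db (i, n)) = F)
                        \<and> (\<forall>i n. \<not> (i < L \<and> n < N i) \<longrightarrow> db (i, n) = [])}"

text \<open>Admissible demands: d i k u is the index (within level i) of the file requested by the
  u-th user of level i connected to cache k.\<close>
definition demands :: "nat \<Rightarrow> nat \<Rightarrow> (nat \<Rightarrow> nat) \<Rightarrow> (nat \<Rightarrow> nat) \<Rightarrow> (nat \<Rightarrow> nat \<Rightarrow> nat \<Rightarrow> nat) set" where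
  "demands K L N U = {d. \<forall>i k u. (i < L \<and> k < K \<and> u < U i \<longrightarrow> d i k u < N i)
                          \<and> (\<not> (i < L \<and> k < K \<and> u < U i) \<longrightarrow> d i k u = 0)}"

text \<open>Error probability (files uniformly distributed) of a scheme consisting of placement
  functions phi (cache k content), delivery function psi (broadcast depending on the demand)
  and decoders mu (user (i,k,u) decodes from demand, broadcast and its cache content).\<close>
definition error_prob ::
  "nat \<Rightarrow> nat \<Rightarrow> (nat \<Rightarrow> nat) \<Rightarrow> (nat \<Rightarrow> nat) \<Rightarrow> nat
   \<Rightarrow> (nat \<Rightarrow> (nat \<times> nat \<Rightarrow> bool list) \<Rightarrow> bool list)
   \<Rightarrow> ((nat \<Rightarrow> nat \<Rightarrow> nat \<Rightarrow> nat) \<Rightarrow> (nat \<times> nat \<Rightarrow> bool list) \<Rightarrow> bool list)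
   \<Rightarrow> ((nat \<Rightarrow> nat \<Rightarrow> nat \<Rightarrow> nat) \<Rightarrow> nat \<Rightarrow> nat \<Rightarrow> nat \<Rightarrow> bool list \<Rightarrow> bool list \<Rightarrow> bool list)
   \<Rightarrow> (nat \<Rightarrow> nat \<Rightarrow> nat \<Rightarrow> nat) \<Rightarrow> real" where
  "error_prob K L N U F phi psi mu d =
     real (card {db \<in> databases L N F. \<exists>i<L. \<exists>k<K. \<exists>u<U i.
                   mu d i k u (psi d db) (phi k db) \<noteq> db (i, d i k u)})
     / real (card (databases L N F))"

definition achievable :: "nat \<Rightarrow> nat \<Rightarrow> (nat \<Rightarrow> nat) \<Rightarrow> (nat \<Rightarrow> nat) \<Rightarrow> real \<Rightarrow> real \<Rightarrow> bool" where
  "achievable K L N U R M \<longleftrightarrow>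
     (\<forall>\<epsilon>>0. \<exists>F0. \<forall>F\<ge>F0. \<exists>phi psi mu.
        (\<forall>k<K. \<forall>db\<in>databases L N F. real (length (phi k db)) \<le> M * real F)
      \<and> (\<forall>d\<in>demands K L N U. \<forall>db\<in>databases L N F. real (length (psi d db)) \<le> R * real F)
      \<and> (\<forall>d\<in>demands K L N U. error_prob K L N U F phi psi mu d \<le> \<epsilon>))"

definition opt_rate :: "nat \<Rightarrow> nat \<Rightarrow> (nat \<Rightarrow> nat) \<Rightarrow> (nat \<Rightarrow> nat) \<Rightarrow> real \<Rightarrow> real" where
  "opt_rate K L N U M = Inf {R. achievable K L N U R M}"

text \<open>Single-level rate U * min(N/M, K) * (1 - M/N), with N/0 = infinity.\<close>
definition rate_SL :: "real \<Rightarrow> nat \<Rightarrow> nat \<Rightarrow> nat \<Rightarrow> real" where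
  "rate_SL M K N U = (if M = 0 then real U * real K * (1 - M / real N)
                      else real U * min (real N / M) (real K) * (1 - M / real N))"

definition feasible_partition ::
  "nat \<Rightarrow> nat \<Rightarrow> (nat \<Rightarrow> nat) \<Rightarrow> (nat \<Rightarrow> nat) \<Rightarrow> real \<Rightarrow> nat set \<Rightarrow> nat set \<Rightarrow> nat set \<Rightarrow> bool" where
  "feasible_partition K L N U M H I J \<longleftrightarrow>
     H \<union> I \<union> J = {..<L} \<and> H \<inter> I = {} \<and> H \<inter> J = {} \<and> I \<inter> J = {} \<and> I \<noteq> {} \<and>
     (let Mt = (M - (\<Sum>j\<in>J. real (N j)) + (\<Sum>i\<in>I. real (N i) / real K))
               / (\<Sum>i\<in>I. sqrt (real (N i) * real (U i)))
      in (\<forall>h\<in>H. Mt < (1 / real K) * sqrt (real (N h) / real (U h)))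
       \<and> (\<forall>i\<in>I. (1 / real K) * sqrt (real (N i) / real (U i)) \<le> Mt
                 \<and> Mt \<le> (1 + 1 / real K) * sqrt (real (N i) / real (U i)))
       \<and> (\<forall>j\<in>J. (1 + 1 / real K) * sqrt (real (N j) / real (U j)) < Mt))"

text \<open>m i is the memory alpha_i M given to level i by the memory-sharing allocation
  (for some M-feasible partition when M < sum of N_i).\<close>
definition ms_allocation ::
  "nat \<Rightarrow> nat \<Rightarrow> (nat \<Rightarrow> nat) \<Rightarrow> (nat \<Rightarrow> nat) \<Rightarrow> real \<Rightarrow> (nat \<Rightarrow> real) \<Rightarrow> bool" where
  "ms_allocation K L N U M m \<longleftrightarrow>
     (if (\<Sum>i<L. real (N i)) \<le> M then (\<forall>i<L. m i = real (N i))
      else (\<exists>H I J. feasible_partition K L N U M H I J \<and>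
             (let Mt = (M - (\<Sum>j\<in>J. real (N j)) + (\<Sum>i\<in>I. real (N i) / real K))
                       / (\<Sum>i\<in>I. sqrt (real (N i) * real (U i)))
              in (\<forall>h\<in>H. m h = 0)
               \<and> (\<forall>i\<in>I. m i = sqrt (real (N i) * real (U i)) * Mt - real (N i) / real K)
               \<and> (\<forall>j\<in>J. m j = real (N j)))))"

definition ms_rate :: "nat \<Rightarrow> nat \<Rightarrow> (nat \<Rightarrow> nat) \<Rightarrow> (nat \<Rightarrow> nat) \<Rightarrow> (nat \<Rightarrow> real) \<Rightarrow> real" where
  "ms_rate K L N U m = (\<Sum>i<L. rate_SL (m i) K (N i) (U i))"

end

theory Submission
  imports Defs "HOL-Library.FuncSet"
begin

text \<open>Converse: fix a slope s = t0 / b0 and let level i use groups of t = t0 2^e caches and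
  b = b0 2^e broadcasts, where e depends on i; with suitable demands any such group reveals the
  same min (N i) (b t U i) files of level i. A group at scale e + 1 is the union of two groups
  at scale e, so submodularity of entropy, conditioned on the files revealed at smaller scales,
  adds up the contributions of all levels:
  R + s M is at least the sum of g i = min (N i / b) (t U i).

  Achievability: let \<mu> be the multiplier written with a tilde over M in the scheme and choose
  s with s \<mu>^2 between 1/32 and 1/16. The memory shares m i add up to M, so it suffices to find for
  each level a scale e with rate i at most 192 (g i - s m i): t close to K for levels in H, t = 1
  for J, and t close to sqrt (s N i / U i), but at least t0, for I.\<close>

section \<open>Entropy of functions on a finite uniform space\<close>

text \<open>A joint variable is a set of indices, so joining variables is union and conditioning is
  a difference of entropies.\<close>

locale uniform_rvs =
  fixes \<Omega> :: "'a set" and Y :: "'v \<Rightarrow> 'a \<Rightarrow> 'b"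
  assumes finite_space: "finite \<Omega>" and space_nonempty: "\<Omega> \<noteq> {}"
begin

text \<open>The atom containing \<omega> of the partition of \<Omega> generated by the variables in
  \<open>S\<close>.\<close>

definition fiber :: "'v set \<Rightarrow> 'a \<Rightarrow> 'a set" where
  "fiber S \<omega> = {\<omega>' \<in> \<Omega>. \<forall>v\<in>S. Y v \<omega>' = Y v \<omega>}"

text \<open>Shannon entropy in bits of the joint variable, written as the mean surprisal over sample
  points, so that no image distribution has to be formed.\<close>

definition entropy :: "'v set \<Rightarrow> real" where
  "entropy S = (\<Sum>\<omega>\<in>\<Omega>. log 2 (real (card \<Omega>) / real (card (fiber S \<omega>)))) / real (card \<Omega>)"

definition determines :: "'v set \<Rightarrow> 'v set \<Rightarrow> bool" where
  "determines A B \<longleftrightarrow> (\<forall>\<omega>\<in>\<Omega>. fiber A \<omega> \<subseteq> fiber B \<omega>)"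

lemma finite_fiber [simp]: "finite (fiber S \<omega>)"
  using finite_space by (simp add: fiber_def)

lemma card_fiber_pos: "\<omega> \<in> \<Omega> \<Longrightarrow> 0 < card (fiber S \<omega>)"
  by (rule card_gt_0_iff[THEN iffD2]) (auto simp: fiber_def finite_space)

lemma card_space_pos: "0 < card \<Omega>"
  using finite_space space_nonempty by (simp add: card_gt_0_iff)

lemma fiber_eq: "\<omega>' \<in> fiber S \<omega> \<Longrightarrow> fiber S \<omega>' = fiber S \<omega>"
  by (auto simp: fiber_def)

lemma fiber_Un: "fiber (A \<union> B) \<omega> = fiber A \<omega> \<inter> fiber B \<omega>"
  by (auto simp: fiber_def)

text \<open>Double counting: the numerator counts the pairs (\<alpha>, \<beta>) in the product of
  the \<open>A\<close>-atom and the \<open>B\<close>-atom of \<omega>. For a fixed pair the matching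
  \<omega> form one atom of \<open>A \<union> B\<close> or none. In the first case their weights add
  up to one over the size of the \<open>C\<close>-atom of \<alpha>, and \<beta> lies in that
  atom.\<close>

lemma sum_fiber_ratio_le:
  assumes "C \<subseteq> A" "C \<subseteq> B"
  shows "(\<Sum>\<omega>\<in>\<Omega>. real (card (fiber A \<omega>)) * real (card (fiber B \<omega>))
            / (real (card (fiber (A \<union> B) \<omega>)) * real (card (fiber C \<omega>)))) \<le> real (card \<Omega>)"
proof -
  define w where "w \<omega> = 1 / (real (card (fiber (A \<union> B) \<omega>)) * real (card (fiber C \<omega>)))" for \<omega>
  have "(\<Sum>\<omega>\<in>\<Omega>. real (card (fiber A \<omega>)) * real (card (fiber B \<omega>))
            / (real (card (fiber (A \<union> B) \<omega>)) * real (card (fiber C \<omega>))))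
      = (\<Sum>\<omega>\<in>\<Omega>. \<Sum>\<alpha>\<in>\<Omega>. \<Sum>\<beta>\<in>\<Omega>. if \<alpha> \<in> fiber A \<omega> \<and> \<beta> \<in> fiber B \<omega> then w \<omega> else 0)"
  proof (rule sum.cong[OF refl])
    fix \<omega> assume "\<omega> \<in> \<Omega>"
    have "(\<Sum>\<alpha>\<in>\<Omega>. \<Sum>\<beta>\<in>\<Omega>. if \<alpha> \<in> fiber A \<omega> \<and> \<beta> \<in> fiber B \<omega> then w \<omega> else 0)
       = (\<Sum>\<alpha>\<in>\<Omega>. if \<alpha> \<in> fiber A \<omega> then (\<Sum>\<beta>\<in>\<Omega>. if \<beta> \<in> fiber B \<omega> then w \<omega> else 0) else 0)"
      by (intro sum.cong) auto
    also have "\<dots> = (\<Sum>\<alpha>\<in>\<Omega> \<inter> fiber A \<omega>. \<Sum>\<beta>\<in>\<Omega> \<inter> fiber B \<omega>. w \<omega>)"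
      by (simp only: sum.inter_restrict[OF finite_space])
    also have "\<Omega> \<inter> fiber A \<omega> = fiber A \<omega>"
      by (auto simp: fiber_def)
    also have "\<Omega> \<inter> fiber B \<omega> = fiber B \<omega>"
      by (auto simp: fiber_def)
    finally show "real (card (fiber A \<omega>)) * real (card (fiber B \<omega>))
            / (real (card (fiber (A \<union> B) \<omega>)) * real (card (fiber C \<omega>)))
        = (\<Sum>\<alpha>\<in>\<Omega>. \<Sum>\<beta>\<in>\<Omega>. if \<alpha> \<in> fiber A \<omega> \<and> \<beta> \<in> fiber B \<omega> then w \<omega> else 0)"
      by (simp add: w_def)
  qed
  also have "\<dots> = (\<Sum>\<alpha>\<in>\<Omega>. \<Sum>\<beta>\<in>\<Omega>. \<Sum>\<omega>\<in>\<Omega>. if \<alpha> \<in> fiber A \<omega> \<and> \<beta> \<in> fiber B \<omega> then w \<omega> else 0)"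
    by (subst sum.swap[where A=\<Omega>], rule sum.cong[OF refl], rule sum.swap)
  also have "\<dots> \<le> (\<Sum>\<alpha>\<in>\<Omega>. \<Sum>\<beta>\<in>\<Omega>. if \<beta> \<in> fiber C \<alpha> then 1 / real (card (fiber C \<alpha>)) else 0)"
  proof (intro sum_mono)
    fix \<alpha> \<beta> assume \<alpha>: "\<alpha> \<in> \<Omega>" and \<beta>: "\<beta> \<in> \<Omega>"
    define T where "T = {\<omega> \<in> \<Omega>. \<alpha> \<in> fiber A \<omega> \<and> \<beta> \<in> fiber B \<omega>}"
    have sum_T: "(\<Sum>\<omega>\<in>\<Omega>. if \<alpha> \<in> fiber A \<omega> \<and> \<beta> \<in> fiber B \<omega> then w \<omega> else 0) = sum w T"
      unfolding T_def by (simp add: sum.inter_filter[OF finite_space])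
    show "(\<Sum>\<omega>\<in>\<Omega>. if \<alpha> \<in> fiber A \<omega> \<and> \<beta> \<in> fiber B \<omega> then w \<omega> else 0)
      \<le> (if \<beta> \<in> fiber C \<alpha> then 1 / real (card (fiber C \<alpha>)) else 0)"
    proof (cases "T = {}")
      case True
      then show ?thesis using sum_T by simp
    next
      case False
      then obtain \<omega>0 where \<omega>0: "\<omega>0 \<in> T" by blast
      have T_eq: "T = fiber (A \<union> B) \<omega>0"
        using \<omega>0 \<alpha> \<beta> by (auto simp: T_def fiber_def)
      have C_eq: "fiber C \<omega>0 = fiber C \<alpha>"
        using \<omega>0 \<alpha> assms by (auto simp: T_def fiber_def subset_iff)
      have "w \<omega> = 1 / (real (card T) * real (card (fiber C \<alpha>)))" if "\<omega> \<in> T" for \<omega>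
      proof -
        have "fiber (A \<union> B) \<omega> = T" using that T_eq fiber_eq by metis
        moreover have "fiber C \<omega> = fiber C \<alpha>"
          using that \<alpha> assms by (auto simp: T_def fiber_def subset_iff)
        ultimately show ?thesis by (simp add: w_def)
      qed
      then have "sum w T = real (card T) * (1 / (real (card T) * real (card (fiber C \<alpha>))))"
        by simp
      also have "\<dots> = 1 / real (card (fiber C \<alpha>))"
        using False T_eq by simp
      finally have "sum w T = 1 / real (card (fiber C \<alpha>))" .
      moreover have "\<beta> \<in> fiber C \<alpha>"
        using \<omega>0 \<beta> assms by (auto simp: T_def fiber_def subset_iff)
      ultimately show ?thesis using sum_T by simp
    qed
  qed
  also have "\<dots> = (\<Sum>\<alpha>\<in>\<Omega>. 1)"
  proof (rule sum.cong[OF refl])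
    fix \<alpha> assume \<alpha>: "\<alpha> \<in> \<Omega>"
    have "(\<Sum>\<beta>\<in>\<Omega>. if \<beta> \<in> fiber C \<alpha> then 1 / real (card (fiber C \<alpha>)) else 0)
      = (\<Sum>\<beta>\<in>\<Omega> \<inter> fiber C \<alpha>. 1 / real (card (fiber C \<alpha>)))"
      by (simp only: sum.inter_restrict[OF finite_space])
    also have "\<Omega> \<inter> fiber C \<alpha> = fiber C \<alpha>" by (auto simp: fiber_def)
    also have "(\<Sum>\<beta>\<in>fiber C \<alpha>. 1 / real (card (fiber C \<alpha>))) = 1"
      using card_fiber_pos[OF \<alpha>, of C] by auto
    finally show "(\<Sum>\<beta>\<in>\<Omega>. if \<beta> \<in> fiber C \<alpha> then 1 / real (card (fiber C \<alpha>)) else 0) = 1" .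
  qed
  finally show ?thesis by simp
qed

text \<open>Jensen's inequality for the logarithm, obtained from
  \<open>ln x \<le> x - 1\<close>.\<close>

lemma sum_log_nonpos:
  fixes f :: "'a \<Rightarrow> real"
  assumes "\<And>\<omega>. \<omega> \<in> \<Omega> \<Longrightarrow> 0 < f \<omega>" and "(\<Sum>\<omega>\<in>\<Omega>. f \<omega>) \<le> real (card \<Omega>)"
  shows "(\<Sum>\<omega>\<in>\<Omega>. log 2 (f \<omega>)) \<le> 0"
proof -
  have "(\<Sum>\<omega>\<in>\<Omega>. log 2 (f \<omega>)) \<le> (\<Sum>\<omega>\<in>\<Omega>. (f \<omega> - 1) / ln 2)"
    using assms(1) by (intro sum_mono) (simp add: log_def divide_right_mono ln_le_minus_one)
  also have "\<dots> = ((\<Sum>\<omega>\<in>\<Omega>. f \<omega>) - real (card \<Omega>)) / ln 2"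
    by (simp add: sum_divide_distrib[symmetric] sum_subtractf)
  also have "\<dots> \<le> 0"
    using assms(2) by (simp add: divide_nonpos_pos)
  finally show ?thesis .
qed

text \<open>Nonnegativity of the mutual information of \<open>A\<close> and \<open>B\<close> given
  \<open>C\<close>: the four entropies combine to the mean logarithm of a ratio whose mean is at
  most 1.\<close>

lemma entropy_submodular:
  assumes "C \<subseteq> A" "C \<subseteq> B"
  shows "entropy (A \<union> B) + entropy C \<le> entropy A + entropy B"
proof -
  let ?f = "\<lambda>\<omega>. real (card (fiber A \<omega>)) * real (card (fiber B \<omega>))
            / (real (card (fiber (A \<union> B) \<omega>)) * real (card (fiber C \<omega>)))"
  let ?l = "\<lambda>S \<omega>. log 2 (real (card \<Omega>) / real (card (fiber S \<omega>)))"
  have "?l (A \<union> B) \<omega> + ?l C \<omega> - ?l A \<omega> - ?l B \<omega> = log 2 (?f \<omega>)" if "\<omega> \<in> \<Omega>" for \<omega>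
    using card_fiber_pos[OF that] card_space_pos
    by (simp add: log_divide_pos log_mult_pos)
  then have "(\<Sum>\<omega>\<in>\<Omega>. ?l (A \<union> B) \<omega>) + (\<Sum>\<omega>\<in>\<Omega>. ?l C \<omega>) - (\<Sum>\<omega>\<in>\<Omega>. ?l A \<omega>) - (\<Sum>\<omega>\<in>\<Omega>. ?l B \<omega>)
      = (\<Sum>\<omega>\<in>\<Omega>. log 2 (?f \<omega>))"
    by (simp add: sum_subtractf[symmetric] sum.distrib[symmetric])
  also have "\<dots> \<le> 0"
    using sum_fiber_ratio_le[OF assms] card_fiber_pos by (intro sum_log_nonpos) auto
  finally have "(\<Sum>\<omega>\<in>\<Omega>. ?l (A \<union> B) \<omega>) + (\<Sum>\<omega>\<in>\<Omega>. ?l C \<omega>) \<le> (\<Sum>\<omega>\<in>\<Omega>. ?l A \<omega>) + (\<Sum>\<omega>\<in>\<Omega>. ?l B \<omega>)"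
    by simp
  then show ?thesis
    unfolding entropy_def add_divide_distrib[symmetric] by (rule divide_right_mono) simp
qed

lemma entropy_empty: "entropy {} = 0"
  using card_space_pos by (simp add: entropy_def fiber_def)

lemma entropy_mono:
  assumes "A \<subseteq> B"
  shows "entropy A \<le> entropy B"
proof -
  have "log 2 (real (card \<Omega>) / real (card (fiber A \<omega>)))
      \<le> log 2 (real (card \<Omega>) / real (card (fiber B \<omega>)))" if "\<omega> \<in> \<Omega>" for \<omega>
  proof -
    have "card (fiber B \<omega>) \<le> card (fiber A \<omega>)"
      using assms by (intro card_mono finite_fiber) (auto simp: fiber_def)
    then show ?thesis
      using card_fiber_pos[OF that] card_space_pos by (simp add: divide_left_mono)
  qed
  then show ?thesis
    unfolding entropy_def by (intro divide_right_mono sum_mono) auto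
qed

lemma entropy_Un_le: "entropy (A \<union> B) \<le> entropy A + entropy B"
  using entropy_submodular[of "{}" A B] entropy_empty by simp

lemma entropy_determined:
  assumes "determines A B"
  shows "entropy (A \<union> B) = entropy A"
proof -
  have "fiber (A \<union> B) \<omega> = fiber A \<omega>" if "\<omega> \<in> \<Omega>" for \<omega>
    using assms that by (auto simp: determines_def fiber_Un)
  then show ?thesis
    unfolding entropy_def by (metis (no_types, lifting) sum.cong)
qed

lemma determines_mono: "determines A B \<Longrightarrow> A \<subseteq> A' \<Longrightarrow> determines A' B"
  unfolding determines_def by (fastforce simp: fiber_def)

lemma entropy_injective:
  assumes "\<And>\<omega> \<omega>'. \<omega> \<in> \<Omega> \<Longrightarrow> \<omega>' \<in> \<Omega> \<Longrightarrow> (\<And>v. v \<in> S \<Longrightarrow> Y v \<omega>' = Y v \<omega>) \<Longrightarrow> \<omega>' = \<omega>"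
  shows "entropy S = log 2 (real (card \<Omega>))"
proof -
  have "fiber S \<omega> = {\<omega>}" if "\<omega> \<in> \<Omega>" for \<omega>
    using assms[OF that] that by (auto simp: fiber_def)
  then have "(\<Sum>\<omega>\<in>\<Omega>. log 2 (real (card \<Omega>) / real (card (fiber S \<omega>)))) = (\<Sum>\<omega>\<in>\<Omega>. log 2 (real (card \<Omega>)))"
    by (intro sum.cong) auto
  then show ?thesis
    using card_space_pos by (simp add: entropy_def)
qed

text \<open>The uniform law maximises entropy; the comparison is with the uniform law on the image
  of \<open>Y v\<close>.\<close>

lemma entropy_singleton_le:
  assumes "Y v ` \<Omega> \<subseteq> B" "finite B"
  shows "entropy {v} \<le> log 2 (real (card B))"
proof -
  define n where "n = card (Y v ` \<Omega>)"
  have n: "0 < n" "n \<le> card B"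
    using assms finite_space space_nonempty by (auto simp: n_def card_gt_0_iff card_mono)
  have "(\<Sum>\<omega>\<in>\<Omega>. 1 / real (card (fiber {v} \<omega>)))
      = (\<Sum>y\<in>Y v ` \<Omega>. \<Sum>\<omega> | \<omega> \<in> \<Omega> \<and> Y v \<omega> = y. 1 / real (card (fiber {v} \<omega>)))"
    using finite_space by (intro sum.image_gen)
  also have "\<dots> = (\<Sum>y\<in>Y v ` \<Omega>. 1)"
  proof (rule sum.cong[OF refl])
    fix y assume "y \<in> Y v ` \<Omega>"
    then obtain \<omega>0 where \<omega>0: "\<omega>0 \<in> \<Omega>" "Y v \<omega>0 = y" by auto
    have "fiber {v} \<omega> = {\<omega> \<in> \<Omega>. Y v \<omega> = y}" if "Y v \<omega> = y" for \<omega>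
      using that by (auto simp: fiber_def)
    then have "(\<Sum>\<omega> | \<omega> \<in> \<Omega> \<and> Y v \<omega> = y. 1 / real (card (fiber {v} \<omega>)))
       = (\<Sum>\<omega> | \<omega> \<in> \<Omega> \<and> Y v \<omega> = y. 1 / real (card {\<omega> \<in> \<Omega>. Y v \<omega> = y}))"
      by (intro sum.cong) auto
    also have "\<dots> = 1"
      using \<omega>0 finite_space by (auto simp: card_gt_0_iff)
    finally show "(\<Sum>\<omega> | \<omega> \<in> \<Omega> \<and> Y v \<omega> = y. 1 / real (card (fiber {v} \<omega>))) = 1" .
  qed
  finally have sum1: "(\<Sum>\<omega>\<in>\<Omega>. 1 / real (card (fiber {v} \<omega>))) = real n"
    by (simp add: n_def)
  \<comment> \<open>The probability \<open>1 / n\<close> of a value under the uniform law on the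
    image, divided by its actual probability.\<close>
  let ?f = "\<lambda>\<omega>. real (card \<Omega>) / real n * (1 / real (card (fiber {v} \<omega>)))"
  have "(\<Sum>\<omega>\<in>\<Omega>. log 2 (real (card \<Omega>) / real (card (fiber {v} \<omega>))))
     = (\<Sum>\<omega>\<in>\<Omega>. log 2 (real n) + log 2 (?f \<omega>))"
    using card_fiber_pos card_space_pos n
    by (intro sum.cong) (auto simp: log_divide_pos log_mult_pos)
  also have "\<dots> = real (card \<Omega>) * log 2 (real n) + (\<Sum>\<omega>\<in>\<Omega>. log 2 (?f \<omega>))"
    by (simp add: sum.distrib)
  also have "(\<Sum>\<omega>\<in>\<Omega>. log 2 (?f \<omega>)) \<le> 0"
  proof (rule sum_log_nonpos)
    show "0 < ?f \<omega>" if "\<omega> \<in> \<Omega>" for \<omega>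
      using card_fiber_pos[OF that] card_space_pos n by simp
    have "(\<Sum>\<omega>\<in>\<Omega>. ?f \<omega>) = real (card \<Omega>) / real n * real n"
      by (simp only: sum_distrib_left[symmetric] sum1)
    then show "(\<Sum>\<omega>\<in>\<Omega>. ?f \<omega>) \<le> real (card \<Omega>)"
      using n by simp
  qed
  finally have "entropy {v} \<le> log 2 (real n)"
    unfolding entropy_def using card_space_pos by (simp add: divide_le_eq mult.commute)
  also have "\<dots> \<le> log 2 (real (card B))"
    using n by simp
  finally show ?thesis .
qed

lemma entropy_le_sum:
  assumes "finite S"
  shows "entropy S \<le> (\<Sum>v\<in>S. entropy {v})"
  using assms
proof (induction S rule: finite_induct)
  case (insert v S)
  then show ?case
    using entropy_Un_le[of "{v}" S] by simp
qed (simp add: entropy_empty)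

text \<open>Each of the two halves of a group reveals the files W j, so subadditivity of the
  entropy conditioned on the files revealed so far discounts them twice.\<close>

lemma entropy_doubling:
  fixes G :: "nat \<Rightarrow> nat \<Rightarrow> 'v set" and V W :: "nat \<Rightarrow> 'v set" and w :: "nat \<Rightarrow> real"
  assumes split: "\<And>j g. G (Suc j) g \<subseteq> G j (2 * g) \<union> G j (2 * g + 1)"
    and det: "\<And>j g. j \<le> E \<Longrightarrow> g < 2 ^ (E - j) \<Longrightarrow> determines (G j g) (W j)"
    and V0: "V 0 = {}" and V_Suc: "\<And>j. V (Suc j) = V j \<union> W j"
    and base: "\<And>g. g < 2 ^ E \<Longrightarrow> entropy (G 0 g) \<le> c"
    and gain: "\<And>j. j \<le> E \<Longrightarrow> w j \<le> entropy (V (Suc j)) - entropy (V j)"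
  shows "(\<Sum>j\<le>E. w j / 2 ^ j) \<le> c"
proof -
  have reveal: "entropy (G j g \<union> V (Suc j)) = entropy (G j g \<union> V j)"
    if "j \<le> E" "g < 2 ^ (E - j)" for j g
    using entropy_determined[OF determines_mono[OF det[OF that], of "G j g \<union> V j"]]
    by (simp add: V_Suc Un_assoc)
  \<comment> \<open>A group at scale \<open>j\<close> consists of \<open>2 ^ j\<close> base groups,
    each with budget \<open>c\<close>. It contains \<open>2 ^ (j - j')\<close> groups of scale
    \<open>j'\<close>, and each of these discounts \<open>w j'\<close> once.\<close>
  have claim: "j \<le> E \<Longrightarrow> g < 2 ^ (E - j) \<Longrightarrow>
      entropy (G j g \<union> V j) - entropy (V j) \<le> 2 ^ j * (c - (\<Sum>j'<j. w j' / 2 ^ j'))" for j g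
  proof (induction j arbitrary: g)
    case 0
    then show ?case using base by (simp add: V0 entropy_empty)
  next
    case (Suc j)
    have j: "j \<le> E" "2 ^ (E - j) = 2 * 2 ^ (E - Suc j)"
      using Suc.prems(1) by (auto simp: power_Suc[symmetric] Suc_diff_Suc simp del: power_Suc)
    define b where "b = 2 ^ j * (c - (\<Sum>j'<j. w j' / 2 ^ j'))"
    have half: "entropy (G j h \<union> V (Suc j)) - entropy (V (Suc j)) \<le> b - w j"
      if "h < 2 ^ (E - j)" for h
      unfolding b_def using Suc.IH[OF j(1) that] reveal[OF j(1) that] gain[OF j(1)] by linarith
    have h: "2 * g < 2 ^ (E - j)" "2 * g + 1 < 2 ^ (E - j)"
      using Suc.prems(2) unfolding j(2) by auto
    have "entropy (G (Suc j) g \<union> V (Suc j))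
        \<le> entropy ((G j (2 * g) \<union> V (Suc j)) \<union> (G j (2 * g + 1) \<union> V (Suc j)))"
      using split[of j g] by (intro entropy_mono) auto
    also have "\<dots> \<le> entropy (G j (2 * g) \<union> V (Suc j)) + entropy (G j (2 * g + 1) \<union> V (Suc j))
        - entropy (V (Suc j))"
      using entropy_submodular[of "V (Suc j)" "G j (2 * g) \<union> V (Suc j)" "G j (2 * g + 1) \<union> V (Suc j)"]
      by simp
    finally have "entropy (G (Suc j) g \<union> V (Suc j)) - entropy (V (Suc j)) \<le> 2 * (b - w j)"
      using add_mono[OF half[OF h(1)] half[OF h(2)]] by (simp add: algebra_simps)
    also have "\<dots> = 2 ^ Suc j * (c - (\<Sum>j'<Suc j. w j' / 2 ^ j'))"
      by (simp add: b_def field_simps)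
    finally show ?case .
  qed
  \<comment> \<open>One group is left at scale \<open>E\<close>; the recursion closes because its
    entropy given all revealed files is nonnegative.\<close>
  have "entropy (V (Suc E)) \<le> entropy (G E 0 \<union> V (Suc E))"
    by (intro entropy_mono) auto
  then have "0 \<le> 2 ^ E * (c - (\<Sum>j'<E. w j' / 2 ^ j')) - w E"
    using claim[of E 0] reveal[of E 0] gain[of E] by simp
  also have "\<dots> = 2 ^ E * (c - (\<Sum>j'\<le>E. w j' / 2 ^ j'))"
    by (simp add: field_simps lessThan_Suc_atMost[symmetric])
  finally show ?thesis
    using mult_le_cancel_left_pos[of "2 ^ E" 0 "c - (\<Sum>j'\<le>E. w j' / 2 ^ j')"] by simp
qed

end

section \<open>The converse bound\<close>

lemma card_bool_lists_length_le: "card {xs :: bool list. length xs \<le> n} \<le> 2 ^ Suc n"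
proof -
  have "(\<Sum>i\<le>n. (2::nat) ^ i) \<le> 2 ^ Suc n"
    by (induction n) auto
  then show ?thesis
    using card_lists_length_le[of "UNIV :: bool set" n] by simp
qed

lemma card_bool_lists_length_eq: "card {xs :: bool list. length xs = n} = 2 ^ n"
  using card_lists_length_eq[of "UNIV :: bool set" n] by simp

lemma finite_bool_lists_length_le: "finite {xs :: bool list. length xs \<le> n}"
  using finite_lists_length_le[of "UNIV :: bool set" n] by simp

lemma finite_bool_lists_length_eq: "finite {xs :: bool list. length xs = n}"
  using finite_lists_length_eq[of "UNIV :: bool set" n] by simp

text \<open>Messages may be shorter than the bound, and there are at most \<open>2 ^ Suc n\<close>
  strings of length up to \<open>n\<close>; this costs the extra bit.\<close>

lemma entropy_bits_le:
  fixes Y :: "'v \<Rightarrow> 'a \<Rightarrow> bool list"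
  assumes "uniform_rvs \<Omega>" and len: "\<And>\<omega>. \<omega> \<in> \<Omega> \<Longrightarrow> real (length (Y v \<omega>)) \<le> x"
  shows "uniform_rvs.entropy \<Omega> Y {v} \<le> x + 1"
proof -
  interpret uniform_rvs \<Omega> Y by fact
  define n where "n = nat \<lfloor>x\<rfloor>"
  obtain \<omega>0 where "\<omega>0 \<in> \<Omega>" using space_nonempty by blast
  then have x: "0 \<le> x" using len[of \<omega>0] by simp
  have "Y v ` \<Omega> \<subseteq> {xs. length xs \<le> n}"
    using len by (auto simp: n_def le_nat_floor)
  then have "entropy {v} \<le> log 2 (real (card {xs :: bool list. length xs \<le> n}))"
    by (rule entropy_singleton_le) (rule finite_bool_lists_length_le)
  also have "\<dots> \<le> log 2 (2 ^ Suc n)"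
  proof -
    have "0 < card {xs :: bool list. length xs \<le> n}"
      using finite_bool_lists_length_le by (auto simp: card_gt_0_iff intro: exI[of _ "[]"])
    moreover have "real (card {xs :: bool list. length xs \<le> n}) \<le> 2 ^ Suc n"
      using card_bool_lists_length_le[of n] by (metis of_nat_le_iff of_nat_numeral of_nat_power)
    ultimately show ?thesis by simp
  qed
  also have "\<dots> = real n + 1"
    by (subst log_nat_power) auto
  also have "\<dots> \<le> x + 1"
    using x by (simp add: n_def)
  finally show ?thesis .
qed

text \<open>Exchanging the default \<open>[]\<close> off the index set for \<open>undefined\<close>
  identifies libraries with an extensional product.\<close>

lemma card_databases:
  "finite (databases L N F)" "card (databases L N F) = 2 ^ (F * (\<Sum>i<L. N i))"
proof -
  define D where "D = (SIGMA i:{..<L}. {..<N i})"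
  define P where "P = PiE D (\<lambda>_. {xs :: bool list. length xs = F})"
  define f where "f = (\<lambda>db :: nat \<times> nat \<Rightarrow> bool list. restrict db D)"
  have D: "finite D" "card D = (\<Sum>i<L. N i)"
    by (simp_all add: D_def)
  have bij: "bij_betw f (databases L N F) P"
  proof (rule bij_betw_byWitness[where f' = "\<lambda>h x. if x \<in> D then h x else []"])
    show "\<forall>a\<in>databases L N F. (\<lambda>x. if x \<in> D then f a x else []) = a"
      by (auto simp: databases_def f_def D_def fun_eq_iff)
    show "\<forall>a'\<in>P. f (\<lambda>x. if x \<in> D then a' x else []) = a'"
      by (auto simp: P_def f_def fun_eq_iff PiE_def extensional_def restrict_def)
    show "f ` databases L N F \<subseteq> P"
      by (auto simp: databases_def f_def P_def D_def split: if_splits)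
    show "(\<lambda>h x. if x \<in> D then h x else []) ` P \<subseteq> databases L N F"
      by (auto simp: databases_def P_def D_def PiE_def Pi_def)
  qed
  have "finite P"
    unfolding P_def by (intro finite_PiE D finite_bool_lists_length_eq)
  then show "finite (databases L N F)"
    using bij_betw_finite[OF bij] by simp
  have "card P = (2 ^ F) ^ card D"
    unfolding P_def by (simp add: card_PiE[OF D(1)] card_bool_lists_length_eq)
  then show "card (databases L N F) = 2 ^ (F * (\<Sum>i<L. N i))"
    using bij_betw_same_card[OF bij] by (simp add: D(2) power_mult)
qed

text \<open>For every g, the users of level i at the caches [g * t i, (g + 1) * t i) request, over
  the broadcasts \<beta> in [g * b i, (g + 1) * b i), the first b i * t i * U i files of the level
  (0 stands in for indices beyond N i): every such group reveals the same set of files.\<close>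

definition window_demand ::
  "nat \<Rightarrow> nat \<Rightarrow> (nat \<Rightarrow> nat) \<Rightarrow> (nat \<Rightarrow> nat) \<Rightarrow> (nat \<Rightarrow> nat) \<Rightarrow> (nat \<Rightarrow> nat) \<Rightarrow> nat
    \<Rightarrow> nat \<Rightarrow> nat \<Rightarrow> nat \<Rightarrow> nat" where
  "window_demand K L N U b t \<beta> i k u =
     (if i < L \<and> k < K \<and> u < U i
      then let n = ((\<beta> mod b i) * t i + k mod t i) * U i + u in if n < N i then n else 0
      else 0)"

lemma window_demand_admissible:
  assumes "\<forall>i<L. 1 \<le> N i"
  shows "window_demand K L N U b t \<beta> \<in> demands K L N U"
  using assms by (auto simp: demands_def window_demand_def Let_def Suc_le_eq)

text \<open>The broadcast, the cache and the user are the mixed-radix digits of \<open>n\<close> in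
  the bases \<open>b i\<close>, \<open>t i\<close> and \<open>U i\<close>. The demand sees \<beta>
  and \<open>k\<close> only modulo \<open>b i\<close> and \<open>t i\<close>, so every group
  contains the required digits.\<close>

lemma window_demand_hits:
  assumes "i < L" "n < N i" "n < b i * t i * U i" "(g + 1) * t i \<le> K"
  obtains k \<beta> u where "k \<in> {g * t i..<(g + 1) * t i}" "\<beta> \<in> {g * b i..<(g + 1) * b i}"
    "k < K" "u < U i" "window_demand K L N U b t \<beta> i k u = n"
proof -
  define q where "q = n div U i"
  have pos: "0 < b i" "0 < t i" "0 < U i"
    using assms(3) by (auto intro: Nat.gr0I)
  define k where "k = g * t i + q mod t i"
  define \<beta> where "\<beta> = g * b i + q div t i"
  have "q < b i * t i"
    unfolding q_def using assms(3) by (simp add: less_mult_imp_div_less)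
  then have q: "q div t i < b i"
    by (simp add: less_mult_imp_div_less)
  have k: "k < (g + 1) * t i" using pos by (simp add: k_def)
  then have kK: "k < K" using assms(4) by simp
  have "(\<beta> mod b i) * t i + k mod t i = q"
    using q by (simp add: \<beta>_def k_def)
  then have "window_demand K L N U b t \<beta> i k (n mod U i) = n"
    using assms(1,2) kK pos by (simp add: window_demand_def Let_def q_def)
  then show thesis
    using that[of k \<beta> "n mod U i"] k kK q pos by (simp add: k_def \<beta>_def)
qed

section \<open>The lower bound at a fixed file size\<close>

datatype rv = Cache nat | Bcast nat | File "nat \<times> nat"

text \<open>Decoding is exact on \<Omega>, which holds at least half of all libraries. The
  restriction costs at most one bit at each of the \<open>Suc E\<close> scales, and variable message
  length costs the other additive terms. None of these corrections grows with
  \<open>F\<close>.\<close>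

lemma converse_fixed_length:
  fixes K L E t0 b0 :: nat and N U e :: "nat \<Rightarrow> nat" and x y :: real
    and phi :: "nat \<Rightarrow> (nat \<times> nat \<Rightarrow> bool list) \<Rightarrow> bool list"
    and psi :: "(nat \<Rightarrow> nat \<Rightarrow> nat \<Rightarrow> nat) \<Rightarrow> (nat \<times> nat \<Rightarrow> bool list) \<Rightarrow> bool list"
  defines "b \<equiv> \<lambda>i. b0 * 2 ^ e i" and "t \<equiv> \<lambda>i. t0 * 2 ^ e i"
  defines "d \<equiv> window_demand K L N U b t"
  assumes e: "\<And>i. i < L \<Longrightarrow> e i \<le> E" and K: "t0 * 2 ^ E \<le> K"
    and \<Omega>: "\<Omega> \<subseteq> databases L N F" "card (databases L N F) \<le> 2 * card \<Omega>"
    and cache: "\<And>k db. k < K \<Longrightarrow> db \<in> \<Omega> \<Longrightarrow> real (length (phi k db)) \<le> x"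
    and bcast: "\<And>\<beta> db. \<beta> < b0 * 2 ^ E \<Longrightarrow> db \<in> \<Omega> \<Longrightarrow> real (length (psi (d \<beta>) db)) \<le> y"
    and decode: "\<And>\<beta> db i k u. \<beta> < b0 * 2 ^ E \<Longrightarrow> db \<in> \<Omega> \<Longrightarrow> i < L \<Longrightarrow> k < K \<Longrightarrow> u < U i \<Longrightarrow>
        mu (d \<beta>) i k u (psi (d \<beta>) db) (phi k db) = db (i, d \<beta> i k u)"
  shows "(\<Sum>i<L. real (min (N i) (b i * t i * U i)) / 2 ^ e i) * real F
    \<le> real t0 * (x + 1) + real b0 * (y + 1) + real (Suc E)"
proof -
  define Y where "Y v = (case v of Cache k \<Rightarrow> phi k | Bcast \<beta> \<Rightarrow> psi (d \<beta>) | File p \<Rightarrow> (\<lambda>db. db p))" for v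
  have Y [simp]: "Y (Cache k) = phi k" "Y (Bcast \<beta>) = psi (d \<beta>)" "Y (File p) db = db p" for k \<beta> p db
    by (simp_all add: Y_def)
  define DB where "DB = databases L N F"
  have card_DB: "card DB = 2 ^ (F * (\<Sum>i<L. N i))" and fin_DB: "finite DB"
    unfolding DB_def by (rule card_databases)+
  have u: "uniform_rvs \<Omega>"
  proof
    show "finite \<Omega>" using \<Omega>(1) fin_DB finite_subset by (auto simp: DB_def)
    show "\<Omega> \<noteq> {}" using \<Omega>(2) card_DB by (auto simp: DB_def)
  qed
  interpret uniform_rvs \<Omega> Y by (rule u)
  define c where "c i = min (N i) (b i * t i * U i)" for i
  define D where "D = (SIGMA i:{..<L}. {..<N i})"
  \<comment> \<open>\<open>W j\<close> gathers the files revealed by any group at scale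
    \<open>j\<close>, over exactly the levels assigned to that scale.\<close>
  define W where "W j = File ` (SIGMA i:{i\<in>{..<L}. e i = j}. {..<c i})" for j
  define V where "V j = (\<Union>j'<j. W j')" for j
  define G where "G j g = Cache ` {g * (t0 * 2 ^ j)..<(g + 1) * (t0 * 2 ^ j)}
      \<union> Bcast ` {g * (b0 * 2 ^ j)..<(g + 1) * (b0 * 2 ^ j)}" for j g
  have D: "finite D" "card D = (\<Sum>i<L. N i)"
    by (simp_all add: D_def)
  have W_sub: "W j \<subseteq> File ` D" for j
    by (auto simp: W_def D_def c_def)
  have card_W: "card (W j) = (\<Sum>i | i \<in> {..<L} \<and> e i = j. c i)" for j
    unfolding W_def by (subst card_image) (auto simp: inj_on_def)
  have file_le: "entropy {v} \<le> real F" if "v \<in> File ` D" for v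
  proof -
    have "Y v ` \<Omega> \<subseteq> {xs. length xs = F}"
      using that \<Omega>(1) by (auto simp: D_def databases_def)
    then have "entropy {v} \<le> log 2 (real (card {xs :: bool list. length xs = F}))"
      by (rule entropy_singleton_le) (rule finite_bool_lists_length_eq)
    also have "\<dots> = real F"
      by (simp add: card_bool_lists_length_eq log_nat_power)
    finally show ?thesis .
  qed
  \<comment> \<open>Halving the sample space lowers the entropy of the whole library by at most one
    bit.\<close>
  have all_files: "real F * real (card D) - 1 \<le> entropy (File ` D)"
  proof -
    have "entropy (File ` D) = log 2 (real (card \<Omega>))"
    proof (rule entropy_injective)
      fix \<omega> \<omega>' assume "\<omega> \<in> \<Omega>" "\<omega>' \<in> \<Omega>" and eq: "\<And>v. v \<in> File ` D \<Longrightarrow> Y v \<omega>' = Y v \<omega>"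
      then have "\<omega> \<in> databases L N F" "\<omega>' \<in> databases L N F" using \<Omega>(1) by auto
      then have "\<omega>' (i, n) = \<omega> (i, n)" for i n
        using eq[of "File (i, n)"] by (cases "i < L \<and> n < N i") (auto simp: D_def databases_def)
      then show "\<omega>' = \<omega>"
        by (simp add: fun_eq_iff)
    qed
    moreover have "log 2 (2 ^ (F * card D) / 2) \<le> log 2 (real (card \<Omega>))"
    proof -
      have "real (card DB) \<le> 2 * real (card \<Omega>)"
        using \<Omega>(2) unfolding DB_def by linarith
      then have "2 ^ (F * card D) / 2 \<le> real (card \<Omega>)"
        by (simp add: card_DB D(2))
      then show ?thesis using card_space_pos by simp
    qed
    moreover have "log 2 (2 ^ (F * card D) / 2) = real F * real (card D) - 1"
      by (subst log_divide_pos) (simp_all add: log_nat_power)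
    ultimately show ?thesis by simp
  qed
  \<comment> \<open>Files need not be independent on \<Omega>. Still, the whole library misses at
    most one bit and each file outside \<open>W j\<close> contributes at most \<open>F\<close>, so
    by submodularity \<open>W j\<close> stays nearly full given \<open>V j\<close>.\<close>
  have gain: "real (card (W j)) * real F - 1 \<le> entropy (V (Suc j)) - entropy (V j)" for j
  proof -
    have V_sub: "V j \<subseteq> File ` D - W j"
    proof -
      have "W j' \<inter> W j = {}" if "j' < j" for j'
        using that by (auto simp: W_def)
      then show ?thesis
        using W_sub unfolding V_def by blast
    qed
    have "V (Suc j) = V j \<union> W j"
      by (auto simp: V_def less_Suc_eq)
    moreover have "(V j \<union> W j) \<union> (File ` D - W j) = File ` D"
      using V_sub W_sub by auto
    ultimately have "entropy (File ` D) + entropy (V j) \<le> entropy (V (Suc j)) + entropy (File ` D - W j)"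
      using entropy_submodular[of "V j" "V j \<union> W j" "File ` D - W j"] V_sub by simp
    moreover have "entropy (File ` D - W j) \<le> (\<Sum>v\<in>File ` D - W j. real F)"
      using D(1) file_le by (intro order.trans[OF entropy_le_sum] sum_mono) auto
    moreover have "card (File ` D - W j) = card D - card (W j)" "card (W j) \<le> card D"
      using W_sub[of j] D(1) card_mono[of "File ` D" "W j"]
      by (simp_all add: card_Diff_subset finite_subset card_image inj_on_def)
    ultimately show ?thesis
      using all_files by (simp add: of_nat_diff algebra_simps)
  qed
  have "(\<Sum>j\<le>E. (real (card (W j)) * real F - 1) / 2 ^ j) \<le> real t0 * (x + 1) + real b0 * (y + 1)"
  proof (rule entropy_doubling[of G E W V])
    show "V 0 = {}" by (simp add: V_def)
    show "V (Suc j) = V j \<union> W j" for j by (auto simp: V_def less_Suc_eq)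
    have halves: "{g * (2 * m)..<(g + 1) * (2 * m)}
        \<subseteq> {(2 * g) * m..<(2 * g + 1) * m} \<union> {(2 * g + 1) * m..<(2 * g + 1 + 1) * m}" for g m :: nat
      by (auto simp: algebra_simps)
    show "G (Suc j) g \<subseteq> G j (2 * g) \<union> G j (2 * g + 1)" for j g
      using halves[of g "t0 * 2 ^ j"] halves[of g "b0 * 2 ^ j"]
      unfolding G_def power_Suc mult.left_commute[of _ 2] by blast
    show "determines (G j g) (W j)" if "j \<le> E" "g < 2 ^ (E - j)" for j g
    proof -
      have le: "(g + 1) * (z * 2 ^ j) \<le> z * 2 ^ E" for z :: nat
      proof -
        have "(g + 1) * 2 ^ j \<le> 2 ^ (E - j) * 2 ^ j"
          using that(2) by (intro mult_right_mono) auto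
        also have "\<dots> = (2 :: nat) ^ E"
          using that(1) by (simp add: power_add[symmetric])
        finally have "z * ((g + 1) * 2 ^ j) \<le> z * 2 ^ E" by (rule mult_left_mono) simp
        then show ?thesis by (simp add: mult.left_commute mult.commute)
      qed
      \<comment> \<open>Libraries that agree on the group's caches and broadcasts feed the same
        inputs to the decoder, and decoding is correct for both.\<close>
      have "Y v \<omega>' = Y v \<omega>" if \<omega>: "\<omega> \<in> \<Omega>" "\<omega>' \<in> \<Omega>" and eq: "\<And>v. v \<in> G j g \<Longrightarrow> Y v \<omega>' = Y v \<omega>"
        and v: "v \<in> W j" for v \<omega> \<omega>'
      proof -
        obtain i n where v_eq: "v = File (i, n)" and i: "i < L" "e i = j" and n: "n < c i"
          using v by (auto simp: W_def)
        have "(g + 1) * t i \<le> K" using le[of t0] K i by (simp add: t_def)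
        then obtain k \<beta> u where k: "k \<in> {g * t i..<(g + 1) * t i}" "k < K"
          and \<beta>: "\<beta> \<in> {g * b i..<(g + 1) * b i}" and u: "u < U i" and du: "d \<beta> i k u = n"
          using window_demand_hits[of i L n N b t U g K] i(1) n unfolding c_def d_def by auto
        have \<beta>': "\<beta> < b0 * 2 ^ E"
          using \<beta> le[of b0] i by (simp add: b_def)
        have "phi k \<omega>' = phi k \<omega>"
          using eq[of "Cache k"] k i by (auto simp: G_def t_def)
        moreover have "psi (d \<beta>) \<omega>' = psi (d \<beta>) \<omega>"
          using eq[of "Bcast \<beta>"] \<beta> i by (auto simp: G_def b_def)
        ultimately have "\<omega>' (i, d \<beta> i k u) = \<omega> (i, d \<beta> i k u)"
          using decode[OF \<beta>' \<omega>(1) i(1) k(2) u] decode[OF \<beta>' \<omega>(2) i(1) k(2) u] by simp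
        then show ?thesis by (simp add: v_eq du)
      qed
      then show ?thesis
        unfolding determines_def fiber_def by blast
    qed
    show "entropy (G 0 g) \<le> real t0 * (x + 1) + real b0 * (y + 1)" if g: "g < 2 ^ E" for g
    proof -
      let ?C = "{g * t0..<(g + 1) * t0}" and ?B = "{g * b0..<(g + 1) * b0}"
      have "(g + 1) * t0 \<le> K"
        using g K mult_right_mono[of "g + 1" "2 ^ E" t0] by (simp add: mult.commute)
      then have C: "entropy {Cache k} \<le> x + 1" if "k \<in> ?C" for k
        using that cache by (intro entropy_bits_le[OF u]) auto
      have "(g + 1) * b0 \<le> b0 * 2 ^ E"
        using g mult_right_mono[of "g + 1" "2 ^ E" b0] by (simp add: mult.commute)
      then have B: "entropy {Bcast \<beta>} \<le> y + 1" if "\<beta> \<in> ?B" for \<beta>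
        using that bcast by (intro entropy_bits_le[OF u]) auto
      have "entropy (G 0 g) \<le> entropy (Cache ` ?C) + entropy (Bcast ` ?B)"
        using entropy_Un_le by (simp add: G_def)
      also have "\<dots> \<le> (\<Sum>v\<in>Cache ` ?C. entropy {v}) + (\<Sum>v\<in>Bcast ` ?B. entropy {v})"
        by (intro add_mono entropy_le_sum) auto
      also have "\<dots> = (\<Sum>k\<in>?C. entropy {Cache k}) + (\<Sum>\<beta>\<in>?B. entropy {Bcast \<beta>})"
        by (simp add: sum.reindex inj_on_def)
      also have "\<dots> \<le> (\<Sum>k\<in>?C. x + 1) + (\<Sum>\<beta>\<in>?B. y + 1)"
        using B C by (intro add_mono sum_mono) auto
      finally show ?thesis by simp
    qed
  qed (rule gain)
  moreover have "(\<Sum>j\<le>E. real (card (W j)) / 2 ^ j) * real F - real (Suc E)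
      \<le> (\<Sum>j\<le>E. (real (card (W j)) * real F - 1) / 2 ^ j)"
  proof -
    have "(\<Sum>j\<le>E. real (card (W j)) / 2 ^ j) * real F - real (Suc E)
      = (\<Sum>j\<le>E. real (card (W j)) / 2 ^ j * real F - 1)"
      by (simp add: sum_subtractf sum_distrib_right)
    also have "\<dots> \<le> (\<Sum>j\<le>E. (real (card (W j)) * real F - 1) / 2 ^ j)"
      by (intro sum_mono) (simp add: diff_divide_distrib)
    finally show ?thesis .
  qed
  moreover have "(\<Sum>j\<le>E. real (card (W j)) / 2 ^ j) = (\<Sum>i<L. real (c i) / 2 ^ e i)"
  proof -
    have "(\<Sum>j\<le>E. real (card (W j)) / 2 ^ j)
      = (\<Sum>j\<le>E. \<Sum>i | i \<in> {..<L} \<and> e i = j. real (c i) / 2 ^ e i)"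
      unfolding card_W by (intro sum.cong) (auto simp: sum_divide_distrib)
    also have "\<dots> = (\<Sum>i<L. real (c i) / 2 ^ e i)"
      using e by (intro sum.group) auto
    finally show ?thesis .
  qed
  ultimately show ?thesis
    by (simp add: c_def)
qed

text \<open>A violation would leave a gap growing linearly in \<open>F\<close>, whereas the
  corrections in \<open>converse_fixed_length\<close> stay bounded.\<close>

lemma converse_bound:
  assumes ach: "achievable K L N U R M" and N: "\<forall>i<L. 1 \<le> N i" and b0: "1 \<le> b0"
    and e: "\<And>i. i < L \<Longrightarrow> e i \<le> E" and K: "t0 * 2 ^ E \<le> K"
  shows "(\<Sum>i<L. real (min (N i) (b0 * 2 ^ e i * (t0 * 2 ^ e i) * U i)) / 2 ^ e i)
    \<le> real t0 * M + real b0 * R"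
proof (rule ccontr)
  define s where "s = (\<Sum>i<L. real (min (N i) (b0 * 2 ^ e i * (t0 * 2 ^ e i) * U i)) / 2 ^ e i)"
  define n where "n = b0 * 2 ^ E"
  assume "\<not> ?thesis"
  then have gap: "0 < s - (real t0 * M + real b0 * R)" by (simp add: s_def)
  have n: "0 < n" using b0 by (simp add: n_def)
  \<comment> \<open>With this error probability the union bound over the \<open>n\<close> demands
    discards at most half of the libraries.\<close>
  define \<epsilon> where "\<epsilon> = 1 / (2 * real n)"
  have "0 < \<epsilon>" using n by (simp add: \<epsilon>_def)
  then obtain F0 where F0: "\<And>F. F0 \<le> F \<Longrightarrow> \<exists>phi psi mu.
        (\<forall>k<K. \<forall>db\<in>databases L N F. real (length (phi k db)) \<le> M * real F)
      \<and> (\<forall>d\<in>demands K L N U. \<forall>db\<in>databases L N F. real (length (psi d db)) \<le> R * real F)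
      \<and> (\<forall>d\<in>demands K L N U. error_prob K L N U F phi psi mu d \<le> \<epsilon>)"
    using ach unfolding achievable_def by blast
  define d where "d = window_demand K L N U (\<lambda>i. b0 * 2 ^ e i) (\<lambda>i. t0 * 2 ^ e i)"
  have d: "d \<beta> \<in> demands K L N U" for \<beta>
    unfolding d_def by (rule window_demand_admissible[OF N])
  have bound: "(s - (real t0 * M + real b0 * R)) * real F \<le> real t0 + real b0 + real (Suc E)"
    if F: "F0 \<le> F" for F
  proof -
    obtain phi psi mu where
      phi: "\<forall>k<K. \<forall>db\<in>databases L N F. real (length (phi k db)) \<le> M * real F" and
      psi: "\<forall>d\<in>demands K L N U. \<forall>db\<in>databases L N F. real (length (psi d db)) \<le> R * real F" and
      err: "\<forall>d\<in>demands K L N U. error_prob K L N U F phi psi mu d \<le> \<epsilon>"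
      using F0[OF F] by blast
    define DB where "DB = databases L N F"
    define bad where "bad \<beta> = {db \<in> DB. \<exists>i<L. \<exists>k<K. \<exists>u<U i.
        mu (d \<beta>) i k u (psi (d \<beta>) db) (phi k db) \<noteq> db (i, d \<beta> i k u)}" for \<beta>
    define \<Omega> where "\<Omega> = DB - (\<Union>\<beta><n. bad \<beta>)"
    have fin: "finite DB" and DB_pos: "0 < card DB"
      unfolding DB_def by (simp_all add: card_databases)
    have bad_le: "real (card (bad \<beta>)) \<le> \<epsilon> * real (card DB)" for \<beta>
      using err[rule_format, OF d[of \<beta>]] DB_pos
      by (simp add: error_prob_def bad_def DB_def divide_le_eq)
    have "real (card (\<Union>\<beta><n. bad \<beta>)) \<le> (\<Sum>\<beta><n. real (card (bad \<beta>)))"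
      using card_UN_le[of "{..<n}" bad] by (simp flip: of_nat_sum)
    also have "\<dots> \<le> (\<Sum>\<beta><n. \<epsilon> * real (card DB))"
      by (intro sum_mono bad_le)
    also have "\<dots> = real (card DB) / 2"
      using n by (simp add: \<epsilon>_def)
    finally have bad_half: "real (card (\<Union>\<beta><n. bad \<beta>)) \<le> real (card DB) / 2" .
    have sub: "(\<Union>\<beta><n. bad \<beta>) \<subseteq> DB" by (auto simp: bad_def)
    have "card DB = card \<Omega> + card (\<Union>\<beta><n. bad \<beta>)"
      unfolding \<Omega>_def using card_Diff_subset[OF finite_subset[OF sub fin] sub] card_mono[OF fin sub]
      by simp
    then have "card DB \<le> 2 * card \<Omega>" using bad_half by linarith
    then have "s * real F \<le> real t0 * (M * real F + 1) + real b0 * (R * real F + 1) + real (Suc E)"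
      unfolding s_def using e K phi psi d
      by (intro converse_fixed_length[of L e E t0 K \<Omega> N F phi "M * real F" b0 psi U "R * real F" mu])
        (auto simp: \<Omega>_def DB_def bad_def n_def d_def)
    then show ?thesis by (simp add: algebra_simps)
  qed
  obtain F1 where "real t0 + real b0 + real (Suc E) < real F1 * (s - (real t0 * M + real b0 * R))"
    using reals_Archimedean3[OF gap] by blast
  also have "\<dots> \<le> real (max F0 F1) * (s - (real t0 * M + real b0 * R))"
    using gap by (intro mult_right_mono) auto
  also have "\<dots> \<le> real t0 + real b0 + real (Suc E)"
    using bound[of "max F0 F1"] by (simp add: mult.commute)
  finally show False by simp
qed

section \<open>Level-wise comparison\<close>

text \<open>Makes the set under the infimum in \<open>opt_rate\<close> nonempty: caches stay empty
  and the broadcast encodes the whole library injectively.\<close>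

lemma achievable_send_all:
  assumes "0 \<le> M"
  shows "achievable K L N U (real (\<Sum>i<L. N i)) M"
  unfolding achievable_def
proof (intro allI impI exI[of _ 0])
  fix \<epsilon> :: real and F :: nat assume "0 < \<epsilon>"
  define DB where "DB = databases L N F"
  obtain f :: "(nat \<times> nat \<Rightarrow> bool list) \<Rightarrow> bool list"
    where f: "f ` DB \<subseteq> {xs. length xs = F * (\<Sum>i<L. N i)}" "inj_on f DB"
    using card_le_inj[of DB "{xs :: bool list. length xs = F * (\<Sum>i<L. N i)}"]
      card_databases[of L N F] finite_bool_lists_length_eq
    by (auto simp: DB_def card_bool_lists_length_eq)
  define mu where "mu d i k u x z = inv_into DB f x (i, d i k u)"
    for d :: "nat \<Rightarrow> nat \<Rightarrow> nat \<Rightarrow> nat" and i k u :: nat and x z :: "bool list"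
  have "error_prob K L N U F (\<lambda>_ _. []) (\<lambda>_. f) mu d = 0" for d
    using f(2) by (simp add: error_prob_def mu_def DB_def cong: conj_cong)
  moreover have len: "real (length (f db)) \<le> real (\<Sum>i<L. N i) * real F" if "db \<in> databases L N F" for db
  proof -
    have "length (f db) = (\<Sum>i<L. N i) * F"
      using f(1) that by (auto simp: DB_def mult.commute)
    then show ?thesis by (simp only: of_nat_mult)
  qed
  ultimately show "\<exists>phi psi mu.
        (\<forall>k<K. \<forall>db\<in>databases L N F. real (length (phi k db)) \<le> M * real F)
      \<and> (\<forall>d\<in>demands K L N U. \<forall>db\<in>databases L N F.
            real (length (psi d db)) \<le> real (\<Sum>i<L. N i) * real F)
      \<and> (\<forall>d\<in>demands K L N U. error_prob K L N U F phi psi mu d \<le> \<epsilon>)"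
    using len \<open>0 < \<epsilon>\<close> assms
    by (intro exI[of _ "\<lambda>_ _. []"] exI[of _ "\<lambda>_. f"] exI[of _ mu] conjI ballI allI impI)
      (simp_all del: of_nat_sum)
qed

lemma opt_rate_ge:
  assumes "0 \<le> M" and "\<And>R. achievable K L N U R M \<Longrightarrow> c \<le> R"
  shows "c \<le> opt_rate K L N U M"
  unfolding opt_rate_def using achievable_send_all[OF assms(1)] assms(2)
  by (intro cInf_greatest) blast+

section \<open>Choice of scale and slope\<close>

lemma dyadic_scale:
  fixes c y :: real
  assumes "0 < c" "c \<le> y"
  obtains e where "c * 2 ^ e \<le> y" "y < c * 2 ^ Suc e"
proof -
  obtain n where n: "y / c < 2 ^ n" using real_arch_pow[of 2 "y / c"] by auto
  define k where "k = (LEAST n. y / c < 2 ^ n)"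
  have k: "y / c < 2 ^ k" unfolding k_def using n by (rule LeastI)
  have "k \<noteq> 0" using k assms by (intro notI) (simp add: field_simps)
  then obtain e where e: "k = Suc e" by (cases k) auto
  have "\<not> y / c < 2 ^ e" using not_less_Least[of e "\<lambda>n. y / c < 2 ^ n"] e k_def by auto
  then show thesis using that[of e] k assms by (simp add: e field_simps)
qed

text \<open>The converse bounds R + s M with s = t0 / b0. For s close to c / \<mu>^2 with a small c,
  charging s per unit of memory costs a partially cached level at most about half of its
  gain; taking t0 = 1 or b0 = 1 makes such a slope available for every \<mu>.\<close>

lemma slope_choice:
  fixes \<mu> :: real
  assumes "0 < \<mu>"
  obtains t0 b0 :: nat where "1 \<le> t0" "1 \<le> b0" "t0 = 1 \<or> b0 = 1"
    "1 / 32 \<le> real t0 / real b0 * \<mu>\<^sup>2" "real t0 / real b0 * \<mu>\<^sup>2 \<le> 1 / 16"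
proof (cases "1 \<le> 16 * \<mu>\<^sup>2")
  case True
  \<comment> \<open>Rounding up a number that is at least 1 at most doubles it, hence the factor 2
    between 1/32 and 1/16.\<close>
  define b where "b = nat \<lceil>16 * \<mu>\<^sup>2\<rceil>"
  have "16 * \<mu>\<^sup>2 \<le> real b" "real b \<le> 16 * \<mu>\<^sup>2 + 1" "1 \<le> b"
    using True unfolding b_def by linarith+
  then show thesis using True by (intro that[of 1 b]) (auto simp: field_simps)
next
  case False
  define y where "y = 1 / (16 * \<mu>\<^sup>2)"
  have y: "1 \<le> y" "y * \<mu>\<^sup>2 = 1 / 16" using False assms by (auto simp: y_def field_simps)
  \<comment> \<open>Dually, rounding down a number that is at least 1 loses at most half of
    it.\<close>
  define t where "t = nat \<lfloor>y\<rfloor>"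
  have "1 \<le> \<lfloor>y\<rfloor>" "real t = of_int \<lfloor>y\<rfloor>"
    using y by (simp_all add: t_def)
  then have t: "1 \<le> t" "real t \<le> y" "y \<le> 2 * real t"
    by linarith+
  have "real t * \<mu>\<^sup>2 \<le> y * \<mu>\<^sup>2" "y * \<mu>\<^sup>2 \<le> 2 * real t * \<mu>\<^sup>2"
    using t by (auto intro: mult_right_mono)
  then show thesis using t y by (intro that[of t 1]) auto
qed

text \<open>Replaces the minimum by a single fraction. For a level in \<open>I\<close> the
  denominator \<open>m + N / K\<close> equals \<open>sqrt (N * U)\<close> times \<mu>, so the
  fraction becomes \<open>p / \<mu>\<close>.\<close>

lemma rate_SL_le:
  assumes "1 \<le> K" "1 \<le> N" "0 \<le> m" "m \<le> real N"
  shows "rate_SL m K N U \<le> 2 * real U * (real N / (m + real N / real K)) * (1 - m / real N)"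
proof (cases "m = 0")
  case True
  then show ?thesis using assms by (simp add: rate_SL_def)
next
  case False
  then have m: "0 < m" using assms by simp
  let ?r = "min (real N / m) (real K)"
  have "?r * (m + real N / real K) \<le> real N / m * m + real K * (real N / real K)"
    unfolding distrib_left using assms m by (intro add_mono mult_right_mono) auto
  also have "\<dots> = 2 * real N" using assms m by simp
  finally have "?r \<le> 2 * (real N / (m + real N / real K))"
    using assms m by (simp add: pos_le_divide_eq add_pos_nonneg)
  then have "real U * ?r * (1 - m / real N)
      \<le> real U * (2 * (real N / (m + real N / real K))) * (1 - m / real N)"
    using assms by (intro mult_right_mono mult_left_mono) auto
  then show ?thesis using False by (simp add: rate_SL_def mult.assoc mult.left_commute)
qed

text \<open>The contribution of a level to the lower bound on R + s M when its groups consist of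
  t0 * 2 ^ e caches and b0 * 2 ^ e broadcasts.\<close>

definition level_gain :: "nat \<Rightarrow> nat \<Rightarrow> nat \<Rightarrow> nat \<Rightarrow> nat \<Rightarrow> real" where
  "level_gain t0 b0 N U e = min (real N / (real b0 * 2 ^ e)) (real t0 * 2 ^ e * real U)"

lemma level_gain_eq:
  assumes "1 \<le> b0"
  shows "real (min N (b0 * 2 ^ e * (t0 * 2 ^ e) * U)) / 2 ^ e = real b0 * level_gain t0 b0 N U e"
proof -
  have "real b0 * level_gain t0 b0 N U e
      = min (real N / 2 ^ e) (real b0 * 2 ^ e * (real t0 * 2 ^ e) * real U / 2 ^ e)"
    using assms by (simp add: level_gain_def min_mult_distrib_left field_simps)
  also have "\<dots> = min (real N) (real b0 * 2 ^ e * (real t0 * 2 ^ e) * real U) / 2 ^ e"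
    by (simp add: min_divide_distrib_right)
  finally show ?thesis by (simp add: of_nat_min)
qed

text \<open>Here p stands for sqrt (N / U), the quantity compared with \<mu> in a feasible partition.\<close>

locale level =
  fixes K N U t0 b0 :: nat and \<mu> p s :: real
  assumes K: "1 \<le> K" and U: "1 \<le> U" and N: "real N = real U * p\<^sup>2" and p: "0 < p" "real K \<le> p\<^sup>2"
    and t0: "1 \<le> t0" "t0 \<le> K" and b0: "1 \<le> b0" and one: "t0 = 1 \<or> b0 = 1"
    and s: "s = real t0 / real b0" and \<mu>: "0 < \<mu>"
    and slope: "1 / 32 \<le> s * \<mu>\<^sup>2" "s * \<mu>\<^sup>2 \<le> 1 / 16"
begin

lemma s_pos: "0 < s"
  using t0 b0 by (simp add: s)

lemma N_pos: "1 \<le> N"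
  using N U p by (cases N) auto

text \<open>In terms of the group size \<open>T = t0 * 2 ^ e\<close> the gain depends on
  \<open>t0\<close> and \<open>b0\<close> only through \<open>s\<close>, and it peaks at
  \<open>T = sqrt s * p\<close>.\<close>

lemma gain_alt:
  "level_gain t0 b0 N U e = real U * min (s * p\<^sup>2 / (real t0 * 2 ^ e)) (real t0 * 2 ^ e)"
  using t0 b0 by (simp add: level_gain_def N s min_mult_distrib_left mult.commute)

text \<open>No memory is charged and the rate is \<open>U * K\<close>. The largest dyadic
  \<open>T\<close> up to \<open>K\<close> exceeds \<open>K / 2\<close>, and
  \<open>p > \<mu> * K\<close> makes the other term of the minimum at least
  \<open>K / 32\<close>.\<close>

lemma uncached_level:
  assumes "\<mu> < p / real K"
  shows "\<exists>e. t0 * 2 ^ e \<le> K \<and> rate_SL 0 K N U \<le> 192 * (level_gain t0 b0 N U e - s * 0)"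
proof -
  obtain e where e: "real t0 * 2 ^ e \<le> real K" "real K < real t0 * 2 ^ Suc e"
    using dyadic_scale[of "real t0" "real K"] t0 by auto
  define T where "T = real t0 * 2 ^ e"
  have T: "T \<le> real K" "real K < 2 * T" "0 < T" using e t0 by (auto simp: T_def)
  have "\<mu> * real K \<le> p" using assms K by (simp add: field_simps)
  then have "(\<mu> * real K)\<^sup>2 \<le> p\<^sup>2" using \<mu> by (intro power_mono) auto
  then have "s * (\<mu> * real K)\<^sup>2 \<le> s * p\<^sup>2" using s_pos by simp
  moreover have "1 / 32 * (real K)\<^sup>2 \<le> s * \<mu>\<^sup>2 * (real K)\<^sup>2"
    using slope by (intro mult_right_mono) auto
  ultimately have "1 / 32 * (real K)\<^sup>2 \<le> s * p\<^sup>2" by (simp add: power_mult_distrib)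
  then have "real K / 32 * T \<le> s * p\<^sup>2"
    using mult_left_mono[OF T(1), of "real K"] by (simp add: power2_eq_square)
  then have "real K / 32 \<le> min (s * p\<^sup>2 / T) T"
    using T by (simp add: pos_le_divide_eq)
  then have "real U * (real K / 32) \<le> level_gain t0 b0 N U e"
    unfolding gain_alt T_def by (intro mult_left_mono) auto
  moreover have "0 \<le> real U * real K" by simp
  ultimately have "real U * real K \<le> 192 * level_gain t0 b0 N U e" by linarith
  then have "rate_SL 0 K N U \<le> 192 * (level_gain t0 b0 N U e - s * 0)"
    by (simp add: rate_SL_def)
  moreover have "real (t0 * 2 ^ e) \<le> real K"
    using e(1) by simp
  ultimately show ?thesis
    unfolding of_nat_le_iff by blast
qed

text \<open>The rate is 0, so the gain only has to cover the charge \<open>s * N\<close>;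
  single-cache groups give exactly this amount.\<close>

lemma fully_cached_level:
  assumes "(1 + 1 / real K) * p < \<mu>"
  shows "\<exists>e. t0 * 2 ^ e \<le> K \<and> rate_SL (real N) K N U \<le> 192 * (level_gain t0 b0 N U e - s * real N)"
proof -
  have "1 \<le> p\<^sup>2" using p(2) K by linarith
  have "p \<le> (1 + 1 / real K) * p" using p by simp
  then have "p \<le> \<mu>" using assms by linarith
  then have "p\<^sup>2 \<le> \<mu>\<^sup>2" using p by (intro power_mono) auto
  \<comment> \<open>Otherwise \<open>b0 = 1\<close> and \<open>s \<ge> 1\<close>, which contradicts
    the upper slope bound because \<mu> is at least \<open>p\<close>, hence at least 1.\<close>
  have "t0 = 1"
  proof (rule ccontr)
    assume "t0 \<noteq> 1"
    then have "1 \<le> s" using one t0 by (auto simp: s)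
    then have "1 * 1 \<le> s * \<mu>\<^sup>2" using \<open>1 \<le> p\<^sup>2\<close> \<open>p\<^sup>2 \<le> \<mu>\<^sup>2\<close> by (intro mult_mono) auto
    then show False using slope by simp
  qed
  have "s * p\<^sup>2 \<le> s * \<mu>\<^sup>2" using \<open>p\<^sup>2 \<le> \<mu>\<^sup>2\<close> s_pos by simp
  then have "s * p\<^sup>2 \<le> 1" using slope by linarith
  then have "level_gain t0 b0 N U 0 = s * real N"
    unfolding gain_alt using \<open>t0 = 1\<close> by (simp add: N)
  then show ?thesis
    using N_pos t0 by (intro exI[of _ 0]) (auto simp: rate_SL_def)
qed

text \<open>The rate is at most \<open>2 * U * x * f\<close> with \<open>f\<close> the uncached
  fraction. If the ideal group size \<open>sqrt s * p\<close> is at least \<open>t0\<close>, a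
  dyadic size within a factor 2 of it leaves \<open>U * x / 24\<close> after the charge. Otherwise
  groups are single caches and \<open>U * x * f / 64\<close> remains.\<close>

lemma partially_cached_level:
  assumes \<mu>p: "p / real K \<le> \<mu>" "\<mu> \<le> (1 + 1 / real K) * p"
    and m: "m = real U * p * \<mu> - real N / real K"
  shows "\<exists>e. t0 * 2 ^ e \<le> K \<and> rate_SL m K N U \<le> 192 * (level_gain t0 b0 N U e - s * m)"
proof -
  define x where "x = p / \<mu>"
  define l where "l = s * \<mu>\<^sup>2"
  have l: "1 / 32 \<le> l" "l \<le> 1 / 16" using slope by (simp_all add: l_def)
  have x: "0 < x" "x \<le> real K" using p \<mu> \<mu>p K by (simp_all add: x_def field_simps)
  have x_half: "1 / 2 \<le> x"
  proof -
    have "(1 + 1 / real K) * p \<le> 2 * p" using p K by (intro mult_right_mono) auto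
    then have "\<mu> \<le> 2 * p" using \<mu>p by linarith
    then show ?thesis using \<mu> by (simp add: x_def field_simps)
  qed
  have m_alt: "m = real U * p * (\<mu> - p / real K)"
    by (simp add: m N power2_eq_square algebra_simps)
  have m0: "0 \<le> m" using \<mu>p p by (simp add: m_alt)
  have "m \<le> real U * p * p"
    unfolding m_alt using \<mu>p p by (intro mult_left_mono) (auto simp: algebra_simps)
  then have mN: "m \<le> real N" by (simp add: N power2_eq_square)
  define f where "f = 1 - m / real N"
  have f: "0 \<le> f" "f \<le> 1" using m0 mN N_pos by (auto simp: f_def)
  have sp: "s * p\<^sup>2 = l * x\<^sup>2" using \<mu> by (simp add: l_def x_def power_divide)
  have "real N / (m + real N / real K) = x"
    using U p \<mu> by (simp add: m N x_def power2_eq_square)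
  then have rate: "rate_SL m K N U \<le> 2 * real U * x * f"
    using rate_SL_le[OF K N_pos m0 mN, of U] by (simp add: f_def)
  show ?thesis
  proof (cases "(real t0)\<^sup>2 \<le> s * p\<^sup>2")
    case True
    \<comment> \<open>\<open>q * x\<close> is the ideal group size \<open>sqrt s * p\<close>; the
      bounds 1/6 and 1/4 on \<open>q\<close> give
      \<open>q * (1 / 2 - q) \<ge> 1 / 24\<close>.\<close>
    define q where "q = sqrt l"
    have q2: "q\<^sup>2 = l" "0 \<le> q" using l by (auto simp: q_def)
    have q_sq: "(1 / 6)\<^sup>2 \<le> q\<^sup>2" "q\<^sup>2 \<le> (1 / 4)\<^sup>2"
      using l unfolding q2(1) by (simp_all add: power2_eq_square)
    have q: "1 / 6 \<le> q" "q \<le> 1 / 4"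
      using power2_le_imp_le[OF q_sq(1) q2(2)] power2_le_imp_le[OF q_sq(2)] by simp_all
    have "(real t0)\<^sup>2 \<le> (q * x)\<^sup>2"
      using True by (simp add: sp power_mult_distrib q2(1))
    then have "real t0 \<le> q * x"
      by (rule power2_le_imp_le) (use q2(2) x in simp)
    then obtain e where e: "real t0 * 2 ^ e \<le> q * x" "q * x < real t0 * 2 ^ Suc e"
      using dyadic_scale[of "real t0" "q * x"] t0 by auto
    define T where "T = real t0 * 2 ^ e"
    have T: "T \<le> q * x" "q * x < 2 * T" "0 < T" using e t0 by (auto simp: T_def)
    have "T * T \<le> (q * x) * (q * x)" using T by (intro mult_mono) auto
    also have "\<dots> = s * p\<^sup>2"
      by (simp only: power2_eq_square[symmetric] power_mult_distrib q2(1) sp)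
    finally have "level_gain t0 b0 N U e = real U * T"
      using T by (simp add: gain_alt T_def[symmetric] pos_le_divide_eq min_absorb2)
    moreover have "s * m \<le> real U * (l * x)"
    proof -
      have "s * m \<le> s * (real U * p * \<mu>)" using s_pos m by (simp add: N)
      also have "\<dots> = real U * (l * x)"
        using \<mu> by (simp add: l_def x_def power2_eq_square)
      finally show ?thesis .
    qed
    moreover have "real U * (x / 24) \<le> real U * (T - l * x)"
    proof (intro mult_left_mono)
      have "1 / 6 * (1 / 4) \<le> q * (1 / 2 - q)" using q by (intro mult_mono) auto
      then have "1 / 24 * x \<le> q * (1 / 2 - q) * x" using x by (intro mult_right_mono) auto
      also have "\<dots> = q * x / 2 - l * x" by (simp add: q2(1)[symmetric] power2_eq_square algebra_simps)
      finally show "x / 24 \<le> T - l * x" using T by linarith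
    qed simp
    ultimately have "real U * (x / 24) \<le> level_gain t0 b0 N U e - s * m"
      by (simp add: right_diff_distrib)
    moreover have "2 * real U * x * f \<le> 2 * real U * x"
      using f x by (intro mult_left_le) auto
    moreover have "0 \<le> real U * x" using x by simp
    moreover have "t0 * 2 ^ e \<le> K"
    proof -
      have "q * x \<le> 1 * x" using q x by (intro mult_right_mono) auto
      then have "real t0 * 2 ^ e \<le> real K" using e(1) x by linarith
      then have "real (t0 * 2 ^ e) \<le> real K" by simp
      then show ?thesis unfolding of_nat_le_iff .
    qed
    ultimately show ?thesis using rate by (intro exI[of _ e]) auto
  next
    case False
    \<comment> \<open>For larger \<open>t0\<close> the slope is \<open>s = t0\<close>, and
      \<open>t0 \<le> K \<le> p^2\<close> would put the level in the previous case.\<close>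
    have "t0 = 1"
    proof (rule ccontr)
      assume "t0 \<noteq> 1"
      then have "s = real t0" using one by (simp add: s)
      moreover have "real t0 * real t0 \<le> real t0 * p\<^sup>2"
        using t0 p by (intro mult_left_mono) auto
      ultimately show False using False by (simp add: power2_eq_square)
    qed
    then have "level_gain t0 b0 N U 0 = s * real N"
      unfolding gain_alt using False by (simp add: N)
    \<comment> \<open>The charge may consume almost all of the gain here, but what remains carries
      the same factor \<open>f\<close> as the rate.\<close>
    then have gain: "level_gain t0 b0 N U 0 - s * m = s * real N * f"
      using N_pos by (simp add: f_def algebra_simps)
    have "real U * (1 / 32 * (1 / 2)) * x \<le> real U * (l * x) * x"
      using l x x_half by (intro mult_right_mono mult_left_mono mult_mono) auto
    also have "\<dots> = s * real N"
      using sp by (simp add: N power2_eq_square)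
    finally have "real U * (1 / 64) * x * f \<le> level_gain t0 b0 N U 0 - s * m"
      unfolding gain using f by (intro mult_right_mono) auto
    moreover have "0 \<le> real U * x * f" using x f by simp
    ultimately show ?thesis
      using rate t0 by (intro exI[of _ 0]) (auto simp: mult_ac)
  qed
qed

end

section \<open>Summing the level-wise comparisons against the converse\<close>

theorem theorem2:
  fixes K L :: nat and N U :: "nat \<Rightarrow> nat" and M :: real and m :: "nat \<Rightarrow> real"
  assumes "K \<ge> 1" and "L \<ge> 1"
    and "\<forall>i<L. U i \<ge> 1"
    and "\<forall>i<L. N i \<ge> K * U i"
    and "\<forall>i<L. \<forall>j<L. i \<noteq> j \<and> real (U i) / real (N i) \<ge> real (U j) / real (N j) \<longrightarrow>
            (real (U i) / real (N i)) / (real (U j) / real (N j)) \<ge> 1 / (1/80)^2"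
    and "M \<ge> 0"
    and "ms_allocation K L N U M m"
  shows "ms_rate K L N U m \<le> 192 * opt_rate K L N U M"
proof -
  have N1: "\<forall>i<L. 1 \<le> N i"
    using assms(1,3,4) by (metis One_nat_def Suc_leI le_trans mult_is_0 neq0_conv not_one_le_zero)
  have "ms_rate K L N U m \<le> 192 * R" if R: "achievable K L N U R M" for R
  proof (cases "(\<Sum>i<L. real (N i)) \<le> M")
    case True
    \<comment> \<open>Taking \<open>t0 = 0\<close> and \<open>b0 = 1\<close> reduces the converse to
      nonnegativity of \<open>R\<close>.\<close>
    have "0 \<le> real 0 * M + real 1 * R"
      using converse_bound[OF R N1, of 1 "\<lambda>_. 0" 0 0] by simp
    moreover have "ms_rate K L N U m = 0"
      using assms(7) True N1 unfolding ms_rate_def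
      by (intro sum.neutral) (auto simp: ms_allocation_def rate_SL_def)
    ultimately show ?thesis by simp
  next
    case False
    define p where "p i = sqrt (real (N i) / real (U i))" for i
    obtain H I J where fp: "feasible_partition K L N U M H I J" and
      alloc: "let Mt = (M - (\<Sum>j\<in>J. real (N j)) + (\<Sum>i\<in>I. real (N i) / real K))
                       / (\<Sum>i\<in>I. sqrt (real (N i) * real (U i)))
              in (\<forall>h\<in>H. m h = 0)
               \<and> (\<forall>i\<in>I. m i = sqrt (real (N i) * real (U i)) * Mt - real (N i) / real K)
               \<and> (\<forall>j\<in>J. m j = real (N j))"
      using assms(7) False by (auto simp: ms_allocation_def)
    define S where "S = (\<Sum>i\<in>I. sqrt (real (N i) * real (U i)))"
    define \<mu> where "\<mu> = (M - (\<Sum>j\<in>J. real (N j)) + (\<Sum>i\<in>I. real (N i) / real K)) / S"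
    have part: "H \<union> I \<union> J = {..<L}" "H \<inter> I = {}" "H \<inter> J = {}" "I \<inter> J = {}" "I \<noteq> {}"
      and H: "\<And>h. h \<in> H \<Longrightarrow> \<mu> < 1 / real K * p h"
      and I: "\<And>i. i \<in> I \<Longrightarrow> 1 / real K * p i \<le> \<mu> \<and> \<mu> \<le> (1 + 1 / real K) * p i"
      and J: "\<And>j. j \<in> J \<Longrightarrow> (1 + 1 / real K) * p j < \<mu>"
      using fp unfolding feasible_partition_def Let_def \<mu>_def S_def p_def by blast+
    have m: "\<And>h. h \<in> H \<Longrightarrow> m h = 0" "\<And>j. j \<in> J \<Longrightarrow> m j = real (N j)"
      "\<And>i. i \<in> I \<Longrightarrow> m i = sqrt (real (N i) * real (U i)) * \<mu> - real (N i) / real K"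
      using alloc unfolding Let_def \<mu>_def S_def by blast+
    have fin: "finite H" "finite I" "finite J"
      using part(1) finite_subset[of _ "{..<L}"] by blast+
    have lvl: "i < L" if "i \<in> H \<or> i \<in> I \<or> i \<in> J" for i using that part(1) by blast
    have pN: "real (N i) = real (U i) * (p i)\<^sup>2" "0 < p i" "real K \<le> (p i)\<^sup>2" if "i < L" for i
    proof -
      have "1 \<le> U i" "1 \<le> N i" "K * U i \<le> N i" using assms(3,4) N1 that by auto
      then show "0 < p i" "real (N i) = real (U i) * (p i)\<^sup>2" "real K \<le> (p i)\<^sup>2"
        by (simp_all add: p_def) (simp add: pos_le_divide_eq flip: of_nat_mult)
    qed
    have sqrt_NU: "sqrt (real (N i) * real (U i)) = real (U i) * p i" if "i < L" for i
      using pN[OF that] by (simp add: real_sqrt_mult mult.commute)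
    have "0 < S"
      unfolding S_def using fin part(5) N1 assms(3) lvl
      by (intro sum_pos) (auto simp: Suc_le_eq)
    then have \<mu>S: "\<mu> * S = M - (\<Sum>j\<in>J. real (N j)) + (\<Sum>i\<in>I. real (N i) / real K)"
      by (simp add: \<mu>_def)
    obtain i0 where i0: "i0 \<in> I" "i0 < L" using part(5) lvl by blast
    have "0 < 1 / real K * p i0" using pN(2)[OF i0(2)] assms(1) by simp
    then have \<mu>: "0 < \<mu>" using I[OF i0(1)] by linarith
    \<comment> \<open>A level in \<open>I\<close> has \<open>p \<le> K * \<mu>\<close> and
      \<open>p^2 \<ge> K\<close>. The bound guarantees below that a base group of \<open>t0\<close>
      caches fits into the \<open>K\<close> caches.\<close>
    have K\<mu>: "1 \<le> real K * \<mu>\<^sup>2"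
    proof -
      have "(1 / real K * p i0)\<^sup>2 \<le> \<mu>\<^sup>2"
        using I[OF i0(1)] pN(2)[OF i0(2)] by (intro power_mono) auto
      then have "(p i0)\<^sup>2 \<le> real K * (real K * \<mu>\<^sup>2)"
        using assms(1) by (simp add: power_divide power2_eq_square field_simps)
      then have "real K * 1 \<le> real K * (real K * \<mu>\<^sup>2)"
        using pN(3)[OF i0(2)] by linarith
      then show ?thesis using assms(1) by simp
    qed
    obtain t0 b0 :: nat where t0: "1 \<le> t0" and b0: "1 \<le> b0" and one: "t0 = 1 \<or> b0 = 1"
      and slope: "1 / 32 \<le> real t0 / real b0 * \<mu>\<^sup>2" "real t0 / real b0 * \<mu>\<^sup>2 \<le> 1 / 16"
      using slope_choice[OF \<mu>] by blast
    define s where "s = real t0 / real b0"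
    have t0K: "t0 \<le> K"
    proof (cases "t0 = 1")
      case False
      then have "real t0 * \<mu>\<^sup>2 \<le> real K * \<mu>\<^sup>2" using one slope K\<mu> by simp
      then show ?thesis using \<mu> by simp
    qed (use assms(1) in simp)
    have "\<exists>e. t0 * 2 ^ e \<le> K
        \<and> rate_SL (m i) K (N i) (U i) \<le> 192 * (level_gain t0 b0 (N i) (U i) e - s * m i)"
      if i: "i < L" for i
    proof -
      interpret level K "N i" "U i" t0 b0 \<mu> "p i" s
        using assms(1,3) i pN[OF i] t0 t0K b0 one \<mu> slope by unfold_locales (auto simp: s_def)
      consider "i \<in> H" | "i \<in> I" | "i \<in> J" using i part(1) by blast
      then show ?thesis
      proof cases
        case 1
        then show ?thesis using uncached_level H[OF 1] m(1) by simp
      next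
        case 2
        then show ?thesis using partially_cached_level I[OF 2] m(3) sqrt_NU[OF i] by simp
      next
        case 3
        then show ?thesis using fully_cached_level J[OF 3] m(2) by simp
      qed
    qed
    then obtain e where e: "\<And>i. i < L \<Longrightarrow> t0 * 2 ^ e i \<le> K"
      and rate: "\<And>i. i < L \<Longrightarrow>
        rate_SL (m i) K (N i) (U i) \<le> 192 * (level_gain t0 b0 (N i) (U i) (e i) - s * m i)"
      by metis
    \<comment> \<open>The maximum is attained by some level, so groups at the largest scale also fit
      into the \<open>K\<close> caches.\<close>
    define E where "E = Max (e ` {..<L})"
    have "E \<in> e ` {..<L}" unfolding E_def using assms(2) by (intro Max_in) (auto simp: lessThan_empty_iff)
    then have EK: "t0 * 2 ^ E \<le> K" using e by auto
    have eE: "e i \<le> E" if "i < L" for i unfolding E_def using that by simp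
    have "real b0 * (\<Sum>i<L. level_gain t0 b0 (N i) (U i) (e i)) \<le> real t0 * M + real b0 * R"
      using converse_bound[OF R N1 b0 eE EK] by (simp add: level_gain_eq[OF b0] sum_distrib_left)
    then have gain: "(\<Sum>i<L. level_gain t0 b0 (N i) (U i) (e i)) \<le> s * M + R"
      using b0 by (simp add: s_def field_simps)
    \<comment> \<open>The numerator of \<mu> is chosen so that the shares exhaust \<open>M\<close>;
      the charges \<open>s * m i\<close> therefore cancel the term \<open>s * M\<close> of the
      converse.\<close>
    have sum_m: "(\<Sum>i<L. m i) = M"
    proof -
      have "(\<Sum>i<L. m i) = (\<Sum>i\<in>H. m i) + (\<Sum>i\<in>I. m i) + (\<Sum>i\<in>J. m i)"
        unfolding part(1)[symmetric] using part(2-4) fin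
        by (simp add: sum.union_disjoint Int_Un_distrib2)
      also have "(\<Sum>i\<in>H. m i) = 0" using m(1) by simp
      also have "(\<Sum>i\<in>J. m i) = (\<Sum>j\<in>J. real (N j))" using m(2) by simp
      also have "(\<Sum>i\<in>I. m i) = S * \<mu> - (\<Sum>i\<in>I. real (N i) / real K)"
        using m(3) by (simp add: S_def sum_subtractf sum_distrib_right)
      finally show ?thesis using \<mu>S by (simp add: mult.commute)
    qed
    have "ms_rate K L N U m \<le> (\<Sum>i<L. 192 * (level_gain t0 b0 (N i) (U i) (e i) - s * m i))"
      unfolding ms_rate_def using rate by (intro sum_mono) auto
    also have "\<dots> = 192 * ((\<Sum>i<L. level_gain t0 b0 (N i) (U i) (e i)) - s * M)"
      by (simp add: sum_distrib_left[symmetric] sum_subtractf sum_m[symmetric])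
    also have "\<dots> \<le> 192 * R" using gain by simp
    finally show ?thesis .
  qed
  then have "ms_rate K L N U m / 192 \<le> opt_rate K L N U M"
    by (intro opt_rate_ge[OF assms(6)]) (simp add: field_simps)
  then show ?thesis by simp
qed

end
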